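(* Let $X$ and $Y$ be bounded distributive lattices, let $n\geqslant 1$ be an integer, and let $f\colon X^n\to Y$ be an order-preserving function whose diagonal section $\delta_f$ is a lattice homomorphism. The following are equivalent: (i) $f$ is a quasi-polynomial function. (ii) $f$ is quasi-$\wedge$-homogeneous and quasi-$\vee$-homogeneous. (iii) $f$ is quasi-$\wedge$-homogeneous and horizontally $\vee$-decomposable. (iv) $f$ is horizontally $\wedge$-decomposable and quasi-$\vee$-homogeneous.
   Context: $X$ and $Y$ are arbitrary, possibly different, bounded distributive lattices, with operations $\wedge,\vee$ and least and greatest elements denoted $0$ and $1$ (in either lattice). $X^n$ is ordered componentwise. Write $[n]=\{1,\ldots,n\}$ and $\mathrm{med}(a,b,c)=(a\wedge b)\vee(b\wedge c)\vee(c\wedge a)$. A lattice homomorphism is a map preserving $\wedge$ and $\vee$ (it is not required to preserve $0$ and $1$). A (lattice) polynomial function $p\colon Y^n\to Y$ is any map which can be obtained as a composition of the lattice operations $\wedge$ and $\vee$, the projections $\mathbf{y}\mapsto y_i$ ($i\in[n]$), and the constant functions $\mathbf{y}\mapsto c$ ($c\in Y$). A function $f\colon X^n\to Y$ is a quasi-polynomial function if there exist a polynomial function $p\colon Y^n\to Y$ and a unary function $\varphi\colon X\to Y$ satisfying $\varphi(x)=\mathrm{med}(\varphi(0),\varphi(x),\varphi(1))$ for every $x\in X$, such that $f(x_1,\ldots,x_n)=p(\varphi(x_1),\ldots,\varphi(x_n))$ for all $x_1,\ldots,x_n\in X$. The diagonal section of $f$ is $\delta_f\colon X\to Y$, $\delta_f(x)=f(x,\ldots,x)$.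 For $\mathbf{x}\in X^n$ and $c\in X$: $\mathbf{x}\wedge c=(x_1\wedge c,\ldots,x_n\wedge c)$, $\mathbf{x}\vee c=(x_1\vee c,\ldots,x_n\vee c)$; $[\mathbf{x}]_c$ is the $n$-tuple whose $i$th component is $0$ if $x_i\leqslant c$, and $x_i$ otherwise; $[\mathbf{x}]^c$ is the $n$-tuple whose $i$th component is $1$ if $x_i\geqslant c$, and $x_i$ otherwise. $f$ is quasi-$\vee$-homogeneous (resp. quasi-$\wedge$-homogeneous) if $f(\mathbf{x}\vee c)=f(\mathbf{x})\vee\delta_f(c)$ (resp. $f(\mathbf{x}\wedge c)=f(\mathbf{x})\wedge\delta_f(c)$) for every $\mathbf{x}\in X^n$ and $c\in X$. $f$ is horizontally $\wedge$-decomposable (resp. horizontally $\vee$-decomposable) if $f(\mathbf{x})=f(\mathbf{x}\vee c)\wedge f([\mathbf{x}]^c)$ (resp. $f(\mathbf{x})=f(\mathbf{x}\wedge c)\vee f([\mathbf{x}]_c)$) for every $\mathbf{x}\in X^n$ and $c\in X$. *)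

theory Defs
  imports Main
begin

text \<open>
  The power $X^n$ is the function type \<^typ>\<open>'n \<Rightarrow> 'x\<close> over an arbitrary finite index type
  \<^typ>\<open>'n\<close> with $n$ elements (types are inhabited, so $n \ge 1$), with the library's pointwise order.
  A bounded distributive lattice is a type of sort \<open>{bounded_lattice, distrib_lattice}\<close>;
  \<^const>\<open>bot\<close> and \<^const>\<open>top\<close> are $0$ and $1$. The one-element lattice is included.
\<close>

definition med :: "'a::lattice \<Rightarrow> 'a \<Rightarrow> 'a \<Rightarrow> 'a" where
  "med a b c = sup (sup (inf a b) (inf b c)) (inf c a)"

definition lattice_hom :: "('x::lattice \<Rightarrow> 'y::lattice) \<Rightarrow> bool" where
  "lattice_hom h \<longleftrightarrow>
     (\<forall>a b. h (inf a b) = inf (h a) (h b)) \<and> (\<forall>a b. h (sup a b) = sup (h a) (h b))"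

inductive polynomial_function :: "(('n \<Rightarrow> 'y::lattice) \<Rightarrow> 'y) \<Rightarrow> bool" where
  proj: "polynomial_function (\<lambda>y. y i)"
| const: "polynomial_function (\<lambda>y. c)"
| inf: "polynomial_function p \<Longrightarrow> polynomial_function q \<Longrightarrow> polynomial_function (\<lambda>y. inf (p y) (q y))"
| sup: "polynomial_function p \<Longrightarrow> polynomial_function q \<Longrightarrow> polynomial_function (\<lambda>y. sup (p y) (q y))"

definition quasi_polynomial_function ::
    "(('n \<Rightarrow> 'x::bounded_lattice) \<Rightarrow> 'y::lattice) \<Rightarrow> bool" where
  "quasi_polynomial_function f \<longleftrightarrow>
     (\<exists>(p :: ('n \<Rightarrow> 'y) \<Rightarrow> 'y) (\<phi> :: 'x \<Rightarrow> 'y).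
        polynomial_function p \<and>
        (\<forall>x. \<phi> x = med (\<phi> bot) (\<phi> x) (\<phi> top)) \<and>
        (\<forall>x. f x = p (\<lambda>i. \<phi> (x i))))"

definition diagonal_section :: "(('n \<Rightarrow> 'x) \<Rightarrow> 'y) \<Rightarrow> 'x \<Rightarrow> 'y" where
  "diagonal_section f c = f (\<lambda>i. c)"

text \<open>The tuples $[\mathbf{x}]_c$ and $[\mathbf{x}]^c$.\<close>

definition lower_cut :: "('n \<Rightarrow> 'x::bounded_lattice) \<Rightarrow> 'x \<Rightarrow> 'n \<Rightarrow> 'x" where
  "lower_cut x c = (\<lambda>i. if x i \<le> c then bot else x i)"

definition upper_cut :: "('n \<Rightarrow> 'x::bounded_lattice) \<Rightarrow> 'x \<Rightarrow> 'n \<Rightarrow> 'x" where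
  "upper_cut x c = (\<lambda>i. if x i \<ge> c then top else x i)"

definition quasi_sup_homogeneous :: "(('n \<Rightarrow> 'x::lattice) \<Rightarrow> 'y::lattice) \<Rightarrow> bool" where
  "quasi_sup_homogeneous f \<longleftrightarrow>
     (\<forall>x c. f (\<lambda>i. sup (x i) c) = sup (f x) (diagonal_section f c))"

definition quasi_inf_homogeneous :: "(('n \<Rightarrow> 'x::lattice) \<Rightarrow> 'y::lattice) \<Rightarrow> bool" where
  "quasi_inf_homogeneous f \<longleftrightarrow>
     (\<forall>x c. f (\<lambda>i. inf (x i) c) = inf (f x) (diagonal_section f c))"

definition horizontally_inf_decomposable ::
    "(('n \<Rightarrow> 'x::bounded_lattice) \<Rightarrow> 'y::lattice) \<Rightarrow> bool" where
  "horizontally_inf_decomposable f \<longleftrightarrow>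
     (\<forall>x c. f x = inf (f (\<lambda>i. sup (x i) c)) (f (upper_cut x c)))"

definition horizontally_sup_decomposable ::
    "(('n \<Rightarrow> 'x::bounded_lattice) \<Rightarrow> 'y::lattice) \<Rightarrow> bool" where
  "horizontally_sup_decomposable f \<longleftrightarrow>
     (\<forall>x c. f x = sup (f (\<lambda>i. inf (x i) c)) (f (lower_cut x c)))"

end

theory Submission
  imports Defs "HOL-Library.Dual_Ordered_Lattice"
begin

text \<open>
  Two facts carry the proof.

  Lattice polynomials are quasi-homogeneous. Induction on polynomials gives
  $p(\mathbf{y} \wedge c) = p(0,\ldots,0) \vee (p(\mathbf{y}) \wedge c)$, and
  $\mathbf{y} = (1,\ldots,1)$ shows that the diagonal section of $p$ is
  $c \mapsto p(0,\ldots,0) \vee (p(1,\ldots,1) \wedge c)$, so the right-hand side is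
  $p(\mathbf{y}) \wedge \delta_p(c)$. Moreover a polynomial does not change when its diagonal section
  is applied to each argument first (\<open>polynomial_absorbs_diagonal\<close>). If
  $f(\mathbf{x}) = p(\varphi(x_1),\ldots,\varphi(x_n))$, then
  $\delta_f = \delta_p \circ \varphi$, so absorption replaces the arbitrary $\varphi$ by the
  homomorphism $\delta_f$: $f(\mathbf{x}) = p(\delta_f(x_1),\ldots,\delta_f(x_n))$. Quasi-homogeneity
  of $p$ now passes to $f$.

  Conversely, a quasi-$\wedge$-homogeneous and horizontally $\vee$-decomposable $f$ satisfies a
  disjunctive normal form of Goodstein's type,
  $f(\mathbf{x}) = \bigvee_I \bigl(f(\mathbf{e}_I) \wedge \bigwedge_{i \in I} \delta_f(x_i)\bigr)$,
  where $\mathbf{e}_I$ is the 0-1 tuple of $I$. The bound from below is homogeneity together with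
  monotonicity. For the bound from above, cutting at $c = x_i$ deletes the coordinate $i$ from the
  support, which permits induction on the support (\<open>le_normal_form\<close>).

  Both homogeneities together imply horizontal decomposability, because
  $\mathbf{x} \leq [\mathbf{x}]_c \vee c$. Finally, passing to the dual lattices exchanges the two
  mixed conditions (homogeneity on one side, decomposability on the other) and preserves the
  conjunction of the two homogeneities, so only one mixed condition needs the normal form.
\<close>

section \<open>Passing to the dual lattices\<close>

definition dualize :: "(('n \<Rightarrow> 'x) \<Rightarrow> 'y) \<Rightarrow> ('n \<Rightarrow> 'x dual) \<Rightarrow> 'y dual" where
  "dualize f x = dual (f (\<lambda>i. undual (x i)))"

lemma all_undual:
  "(\<forall>(x :: 'n \<Rightarrow> 'x dual) (c :: 'z dual). P (\<lambda>i. undual (x i)) (undual c)) \<longleftrightarrow> (\<forall>x c. P x c)"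
proof
  assume *: "\<forall>(x :: 'n \<Rightarrow> 'x dual) (c :: 'z dual). P (\<lambda>i. undual (x i)) (undual c)"
  show "\<forall>x c. P x c"
  proof (intro allI)
    fix x :: "'n \<Rightarrow> 'x" and c :: 'z
    show "P x c" using *[rule_format, of "\<lambda>i. dual (x i)" "dual c"] by simp
  qed
qed simp

lemma diagonal_section_dualize:
  "diagonal_section (dualize f) c = dual (diagonal_section f (undual c))"
  by (simp add: diagonal_section_def dualize_def)

lemma mono_dualize:
  fixes f :: "('n \<Rightarrow> 'x::order) \<Rightarrow> 'y::order"
  assumes "mono f"
  shows "mono (dualize f)"
proof (rule monoI)
  fix x y :: "'n \<Rightarrow> 'x dual"
  assume "x \<le> y"
  then have "(\<lambda>i. undual (y i)) \<le> (\<lambda>i. undual (x i))"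
    by (simp add: le_fun_def dual_less_eq_iff)
  then show "dualize f x \<le> dualize f y"
    unfolding dualize_def by (simp add: monoD[OF assms])
qed

lemma lattice_hom_diagonal_dualize:
  assumes "lattice_hom (diagonal_section f)"
  shows "lattice_hom (diagonal_section (dualize f))"
  using assms by (simp add: lattice_hom_def diagonal_section_dualize)

lemma quasi_inf_homogeneous_dualize:
  "quasi_inf_homogeneous (dualize f) \<longleftrightarrow> quasi_sup_homogeneous f"
proof -
  have "quasi_inf_homogeneous (dualize f) \<longleftrightarrow>
      (\<forall>x c. f (\<lambda>i. sup (undual (x i)) (undual c)) =
        sup (f (\<lambda>i. undual (x i))) (diagonal_section f (undual c)))"
    by (simp add: quasi_inf_homogeneous_def dualize_def diagonal_section_def dual_eq_iff)
  also have "\<dots> \<longleftrightarrow> quasi_sup_homogeneous f"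
    unfolding quasi_sup_homogeneous_def
    by (rule all_undual[where P = "\<lambda>x c. f (\<lambda>i. sup (x i) c) = sup (f x) (diagonal_section f c)"])
  finally show ?thesis .
qed

lemma quasi_sup_homogeneous_dualize:
  "quasi_sup_homogeneous (dualize f) \<longleftrightarrow> quasi_inf_homogeneous f"
proof -
  have "quasi_sup_homogeneous (dualize f) \<longleftrightarrow>
      (\<forall>x c. f (\<lambda>i. inf (undual (x i)) (undual c)) =
        inf (f (\<lambda>i. undual (x i))) (diagonal_section f (undual c)))"
    by (simp add: quasi_sup_homogeneous_def dualize_def diagonal_section_def dual_eq_iff)
  also have "\<dots> \<longleftrightarrow> quasi_inf_homogeneous f"
    unfolding quasi_inf_homogeneous_def
    by (rule all_undual[where P = "\<lambda>x c. f (\<lambda>i. inf (x i) c) = inf (f x) (diagonal_section f c)"])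
  finally show ?thesis .
qed

lemma horizontally_sup_decomposable_dualize:
  "horizontally_sup_decomposable (dualize f) \<longleftrightarrow> horizontally_inf_decomposable f"
proof -
  have cut: "(\<lambda>i. undual (lower_cut x c i)) = upper_cut (\<lambda>i. undual (x i)) (undual c)"
    for x :: "'a \<Rightarrow> 'b dual" and c
    by (simp add: lower_cut_def upper_cut_def fun_eq_iff dual_less_eq_iff)
  have "horizontally_sup_decomposable (dualize f) \<longleftrightarrow>
      (\<forall>x c. f (\<lambda>i. undual (x i)) =
        inf (f (\<lambda>i. sup (undual (x i)) (undual c))) (f (upper_cut (\<lambda>i. undual (x i)) (undual c))))"
    by (simp add: horizontally_sup_decomposable_def dualize_def cut dual_eq_iff)
  also have "\<dots> \<longleftrightarrow> horizontally_inf_decomposable f"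
    unfolding horizontally_inf_decomposable_def
    by (rule all_undual[where P = "\<lambda>x c. f x = inf (f (\<lambda>i. sup (x i) c)) (f (upper_cut x c))"])
  finally show ?thesis .
qed

lemma polynomial_function_dualize:
  "polynomial_function p \<Longrightarrow> polynomial_function (dualize p)"
proof (induction rule: polynomial_function.induct)
  case (proj i)
  show ?case using polynomial_function.proj[of i] by (simp add: dualize_def[abs_def])
next
  case (const c)
  show ?case using polynomial_function.const[of "dual c"] by (simp add: dualize_def[abs_def])
next
  case (inf p q)
  show ?case using polynomial_function.sup[OF inf.IH] by (simp add: dualize_def[abs_def])
next
  case (sup p q)
  show ?case using polynomial_function.inf[OF sup.IH] by (simp add: dualize_def[abs_def])
qed

section \<open>Lattice polynomials\<close>

lemma mono_polynomial_function:
  "polynomial_function p \<Longrightarrow> mono p"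
proof (induction rule: polynomial_function.induct)
  case (inf p q)
  then show ?case by (auto simp: mono_def intro: le_infI1 le_infI2)
next
  case (sup p q)
  then show ?case by (auto simp: mono_def intro: le_supI1 le_supI2)
qed (simp_all add: mono_def le_fun_def monotone_on_def)

text \<open>
  Stating homogeneity with the constant $p(0,\ldots,0)$, and not with $\delta_p(c)$, is what makes
  the induction pass through joins: $(a \wedge a') \vee (b \wedge b')$ and
  $(a \vee b) \wedge (a' \vee b')$ differ in general.
\<close>

lemma polynomial_function_inf_tuple:
  fixes p :: "('n \<Rightarrow> 'y::{bounded_lattice, distrib_lattice}) \<Rightarrow> 'y"
  assumes "polynomial_function p"
  shows "p (\<lambda>i. inf (y i) c) = sup (p (\<lambda>i. bot)) (inf (p y) c)"
  using assms
proof (induction rule: polynomial_function.induct)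
  case (proj i)
  show ?case by simp
next
  case (const a)
  show ?case by (simp add: sup_inf_absorb)
next
  case (inf p q)
  have le: "p (\<lambda>i. bot) \<le> p y" "q (\<lambda>i. bot) \<le> q y"
    using inf.hyps[THEN mono_polynomial_function] by (auto simp: mono_def le_fun_def)
  have "inf (sup a (inf b c)) (sup a' (inf b' c)) = sup (inf a a') (inf (inf b b') c)"
    if "a \<le> b" "a' \<le> b'" for a b a' b' :: 'y
  proof -
    have "sup (inf a (inf b' c)) (inf (inf b c) a') \<le> inf (inf b b') c"
      using that by (auto intro: le_infI1 le_infI2)
    then show ?thesis
      by (simp add: inf_sup_distrib1 inf_sup_distrib2 inf_sup_aci sup_absorb2)
  qed
  from this[OF le] show ?case by (simp add: inf.IH)
next
  case (sup p q)
  then show ?case by (simp add: inf_sup_distrib1 inf_sup_distrib2 inf_sup_aci)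
qed

lemma diagonal_section_polynomial:
  fixes p :: "('n \<Rightarrow> 'y::{bounded_lattice, distrib_lattice}) \<Rightarrow> 'y"
  assumes "polynomial_function p"
  shows "diagonal_section p c = sup (p (\<lambda>i. bot)) (inf (p (\<lambda>i. top)) c)"
  using polynomial_function_inf_tuple[OF assms, of "\<lambda>i. top" c] by (simp add: diagonal_section_def)

lemma polynomial_quasi_inf_homogeneous:
  fixes p :: "('n \<Rightarrow> 'y::{bounded_lattice, distrib_lattice}) \<Rightarrow> 'y"
  assumes "polynomial_function p"
  shows "quasi_inf_homogeneous p"
  unfolding quasi_inf_homogeneous_def
proof (intro allI)
  fix y and c :: 'y
  have le: "p (\<lambda>i. bot) \<le> p y" "p y \<le> p (\<lambda>i. top)"
    using mono_polynomial_function[OF assms] by (auto simp: mono_def le_fun_def)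
  have "inf (p y) (diagonal_section p c) =
      sup (inf (p y) (p (\<lambda>i. bot))) (inf (inf (p y) (p (\<lambda>i. top))) c)"
    by (simp add: diagonal_section_polynomial[OF assms] inf_sup_distrib1 inf_assoc)
  also have "\<dots> = p (\<lambda>i. inf (y i) c)"
    by (simp add: polynomial_function_inf_tuple[OF assms] le inf_absorb1 inf_absorb2)
  finally show "p (\<lambda>i. inf (y i) c) = inf (p y) (diagonal_section p c)" ..
qed

lemma polynomial_quasi_sup_homogeneous:
  fixes p :: "('n \<Rightarrow> 'y::{bounded_lattice, distrib_lattice}) \<Rightarrow> 'y"
  assumes "polynomial_function p"
  shows "quasi_sup_homogeneous p"
  using polynomial_quasi_inf_homogeneous[OF polynomial_function_dualize[OF assms]]
  by (simp add: quasi_inf_homogeneous_dualize)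

text \<open>
  The diagonal section of $p$ is truncation to the interval between $p(0,\ldots,0)$ and
  $p(1,\ldots,1)$. By homogeneity, truncating the arguments truncates the value, which already lies
  in this interval.
\<close>

lemma polynomial_absorbs_diagonal:
  fixes p :: "('n \<Rightarrow> 'y::{bounded_lattice, distrib_lattice}) \<Rightarrow> 'y"
  assumes "polynomial_function p"
  shows "p (\<lambda>i. diagonal_section p (y i)) = p y"
proof -
  let ?a = "p (\<lambda>i. bot)" and ?b = "p (\<lambda>i. top)"
  have le: "?a \<le> p y" "p y \<le> ?b" "?a \<le> ?b"
    using mono_polynomial_function[OF assms] by (auto simp: mono_def le_fun_def)
  have "p (\<lambda>i. diagonal_section p (y i)) = p (\<lambda>i. sup (inf (y i) ?b) ?a)"
    by (simp add: diagonal_section_polynomial[OF assms] sup_commute inf_commute)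
  also have "\<dots> = sup (inf (p y) (diagonal_section p ?b)) (diagonal_section p ?a)"
    using polynomial_quasi_inf_homogeneous[OF assms] polynomial_quasi_sup_homogeneous[OF assms]
    by (simp add: quasi_inf_homogeneous_def quasi_sup_homogeneous_def)
  also have "\<dots> = p y"
    by (simp add: diagonal_section_polynomial[OF assms] le inf_absorb1 sup_absorb1 sup_absorb2)
  finally show ?thesis .
qed

lemma quasi_polynomial_imp_quasi_homogeneous:
  fixes f :: "('n \<Rightarrow> 'x::bounded_lattice) \<Rightarrow> 'y::{bounded_lattice, distrib_lattice}"
  assumes "quasi_polynomial_function f" and hom: "lattice_hom (diagonal_section f)"
  shows "quasi_inf_homogeneous f" and "quasi_sup_homogeneous f"
proof -
  obtain p \<phi> where p: "polynomial_function p" and f: "\<And>x. f x = p (\<lambda>i. \<phi> (x i))"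
    using assms(1) unfolding quasi_polynomial_function_def by blast
  have "diagonal_section f c = diagonal_section p (\<phi> c)" for c
    by (simp add: diagonal_section_def f)
  then have normal: "f x = p (\<lambda>i. diagonal_section f (x i))" for x
    using polynomial_absorbs_diagonal[OF p, of "\<lambda>i. \<phi> (x i)"] by (simp add: f)
  have diag: "diagonal_section p (diagonal_section f c) = diagonal_section f c" for c
    using normal[of "\<lambda>i. c"] by (simp add: diagonal_section_def[of p] diagonal_section_def[of f c])
  show "quasi_inf_homogeneous f"
    unfolding quasi_inf_homogeneous_def
  proof (intro allI)
    fix x c
    have "f (\<lambda>i. inf (x i) c) = p (\<lambda>i. inf (diagonal_section f (x i)) (diagonal_section f c))"
      using hom by (simp add: normal[of "\<lambda>i. inf (x i) c"] lattice_hom_def)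
    also have "\<dots> = inf (f x) (diagonal_section f c)"
      using polynomial_quasi_inf_homogeneous[OF p]
      by (simp add: quasi_inf_homogeneous_def normal[of x] diag)
    finally show "f (\<lambda>i. inf (x i) c) = inf (f x) (diagonal_section f c)" .
  qed
  show "quasi_sup_homogeneous f"
    unfolding quasi_sup_homogeneous_def
  proof (intro allI)
    fix x c
    have "f (\<lambda>i. sup (x i) c) = p (\<lambda>i. sup (diagonal_section f (x i)) (diagonal_section f c))"
      using hom by (simp add: normal[of "\<lambda>i. sup (x i) c"] lattice_hom_def)
    also have "\<dots> = sup (f x) (diagonal_section f c)"
      using polynomial_quasi_sup_homogeneous[OF p]
      by (simp add: quasi_sup_homogeneous_def normal[of x] diag)
    finally show "f (\<lambda>i. sup (x i) c) = sup (f x) (diagonal_section f c)" .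
  qed
qed

section \<open>Homogeneity and decomposability\<close>

text \<open>
  From $\mathbf{x} \leq [\mathbf{x}]_c \vee c$ and $\vee$-homogeneity,
  $f(\mathbf{x}) \leq f([\mathbf{x}]_c) \vee \delta_f(c)$; meeting with $f(\mathbf{x})$ and using
  $\wedge$-homogeneity turns the second term into $f(\mathbf{x} \wedge c)$.
\<close>

lemma quasi_homogeneous_imp_horizontally_sup_decomposable:
  fixes f :: "('n \<Rightarrow> 'x::bounded_lattice) \<Rightarrow> 'y::distrib_lattice"
  assumes "mono f" "quasi_inf_homogeneous f" "quasi_sup_homogeneous f"
  shows "horizontally_sup_decomposable f"
  unfolding horizontally_sup_decomposable_def
proof (intro allI)
  fix x c
  have lower: "f (lower_cut x c) \<le> f x"
    by (auto intro!: monoD[OF assms(1)] simp: le_fun_def lower_cut_def)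
  have "f x \<le> f (\<lambda>i. sup (lower_cut x c i) c)"
    by (auto intro!: monoD[OF assms(1)] simp: le_fun_def lower_cut_def)
  also have "\<dots> = sup (f (lower_cut x c)) (diagonal_section f c)"
    using assms(3) by (simp add: quasi_sup_homogeneous_def)
  finally have "f x = inf (f x) (sup (f (lower_cut x c)) (diagonal_section f c))"
    by (simp add: inf_absorb1)
  also have "\<dots> = sup (inf (f x) (diagonal_section f c)) (f (lower_cut x c))"
    using lower by (simp add: inf_sup_distrib1 inf_absorb2 sup_commute)
  also have "inf (f x) (diagonal_section f c) = f (\<lambda>i. inf (x i) c)"
    using assms(2) by (simp add: quasi_inf_homogeneous_def)
  finally show "f x = sup (f (\<lambda>i. inf (x i) c)) (f (lower_cut x c))" .
qed

section \<open>The disjunctive normal form\<close>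

text \<open>The element \<^const>\<open>top\<close> is inserted so that the meet over the empty set of indices is $1$.\<close>

definition meet_over :: "'n set \<Rightarrow> ('n \<Rightarrow> 'y::bounded_lattice) \<Rightarrow> 'y" where
  "meet_over I y = Inf_fin (insert top (y ` I))"

definition zero_one_tuple :: "'n set \<Rightarrow> 'n \<Rightarrow> 'x::bounded_lattice" where
  "zero_one_tuple I i = (if i \<in> I then top else bot)"

definition normal_form ::
    "(('n::finite \<Rightarrow> 'x::bounded_lattice) \<Rightarrow> 'y::bounded_lattice) \<Rightarrow> ('n \<Rightarrow> 'y) \<Rightarrow> 'y" where
  "normal_form f y = Sup_fin (range (\<lambda>I. inf (f (zero_one_tuple I)) (meet_over I y)))"

lemma meet_over_empty: "meet_over {} y = top"
  by (simp add: meet_over_def)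

lemma meet_over_insert:
  assumes "finite I"
  shows "meet_over (insert i I) y = inf (y i) (meet_over I y)"
  using assms by (simp add: meet_over_def insert_commute[of top])

lemma meet_over_lower:
  fixes I :: "'n::finite set"
  assumes "i \<in> I"
  shows "meet_over I y \<le> y i"
  unfolding meet_over_def using assms by (auto intro!: Inf_fin.coboundedI)

lemma le_sup_meet_over:
  fixes y :: "'n::finite \<Rightarrow> 'y::{bounded_lattice, distrib_lattice}"
  assumes "\<And>i. i \<in> I \<Longrightarrow> a \<le> sup b (y i)"
  shows "a \<le> sup b (meet_over I y)"
proof -
  have "finite I" by simp
  then show ?thesis using assms
    by (induction I) (auto simp: meet_over_empty meet_over_insert sup_inf_distrib1)
qed

lemma lattice_hom_meet_over:
  fixes x :: "'n::finite \<Rightarrow> 'x::bounded_lattice" and h :: "'x \<Rightarrow> 'y::bounded_lattice"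
  assumes "lattice_hom h"
  shows "h (meet_over I x) = inf (h top) (meet_over I (\<lambda>i. h (x i)))"
proof -
  have "finite I" by simp
  then show ?thesis
    using assms
    by (induction I) (simp_all add: meet_over_empty meet_over_insert lattice_hom_def inf_left_commute)
qed

lemma polynomial_function_meet_over:
  fixes I :: "'n::finite set"
  shows "polynomial_function (\<lambda>y. meet_over I y)"
proof -
  have "finite I" by simp
  then show ?thesis
    by (induction I)
      (auto simp: meet_over_empty meet_over_insert intro: polynomial_function.intros)
qed

lemma polynomial_function_Sup_fin:
  assumes "finite A" "A \<noteq> {}" "\<And>a. a \<in> A \<Longrightarrow> polynomial_function (p a)"
  shows "polynomial_function (\<lambda>y. Sup_fin ((\<lambda>a. p a y) ` A))"
  using assms
  by (induction A rule: finite_ne_induct) (auto intro: polynomial_function.sup)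

lemma polynomial_function_normal_form: "polynomial_function (normal_form f)"
  unfolding normal_form_def[abs_def]
  by (intro polynomial_function_Sup_fin polynomial_function.inf polynomial_function.const
      polynomial_function_meet_over) auto

lemma normal_form_upper: "inf (f (zero_one_tuple I)) (meet_over I y) \<le> normal_form f y"
  unfolding normal_form_def by (intro Sup_fin.coboundedI) auto

text \<open>
  Each disjunct is bounded because $\mathbf{e}_I \wedge \bigwedge_{i \in I} x_i \leq \mathbf{x}$
  and $f$ is $\wedge$-homogeneous.
\<close>

lemma normal_form_le:
  fixes f :: "('n::finite \<Rightarrow> 'x::bounded_lattice) \<Rightarrow> 'y::bounded_lattice"
  assumes "mono f" "lattice_hom (diagonal_section f)" "quasi_inf_homogeneous f"
  shows "normal_form f (\<lambda>i. diagonal_section f (x i)) \<le> f x"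
proof -
  have "inf (f (zero_one_tuple I)) (meet_over I (\<lambda>i. diagonal_section f (x i))) \<le> f x" for I
  proof -
    \<comment> \<open>As $\delta_f$ need not preserve $1$, moving it out of the meet leaves a factor $\delta_f(1)$
      (all that remains for empty \<^term>\<open>I\<close>); the value at the 0-1 tuple absorbs it.\<close>
    have "f (zero_one_tuple I) \<le> diagonal_section f top"
      unfolding diagonal_section_def by (auto intro!: monoD[OF assms(1)] simp: le_fun_def)
    then have "inf (f (zero_one_tuple I)) (meet_over I (\<lambda>i. diagonal_section f (x i))) =
        inf (f (zero_one_tuple I)) (diagonal_section f (meet_over I x))"
      by (simp add: lattice_hom_meet_over[OF assms(2)] inf_absorb1 flip: inf_assoc)
    also have "\<dots> = f (\<lambda>i. inf (zero_one_tuple I i) (meet_over I x))"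
      using assms(3) by (simp add: quasi_inf_homogeneous_def)
    also have "\<dots> \<le> f x"
      by (auto intro!: monoD[OF assms(1)] simp: le_fun_def zero_one_tuple_def meet_over_lower)
    finally show ?thesis .
  qed
  then show ?thesis
    unfolding normal_form_def by (intro Sup_fin.boundedI) auto
qed

text \<open>
  Let $S$ be the support of $\mathbf{x}$ and $i \in S$. The cut at $c = x_i$ gives
  $f(\mathbf{x}) \leq \delta_f(x_i) \vee f([\mathbf{x}]_{x_i})$, and the support of
  $[\mathbf{x}]_{x_i}$ is smaller, so the induction hypothesis bounds the second term by the normal
  form $N$ at $\mathbf{x}$. Taking the meet over all $i \in S$ yields
  $f(\mathbf{x}) \leq N \vee \bigwedge_{i \in S} \delta_f(x_i)$. As also
  $f(\mathbf{x}) \leq f(\mathbf{e}_S)$, the disjunct of $N$ for $I = S$ absorbs the last meet.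
\<close>

lemma le_normal_form:
  fixes f :: "('n::finite \<Rightarrow> 'x::bounded_lattice) \<Rightarrow> 'y::{bounded_lattice, distrib_lattice}"
  assumes "mono f" "quasi_inf_homogeneous f" "horizontally_sup_decomposable f"
  shows "f x \<le> normal_form f (\<lambda>i. diagonal_section f (x i))"
proof (induction "card {i. x i \<noteq> bot}" arbitrary: x rule: less_induct)
  case less
  let ?\<delta> = "diagonal_section f"
  let ?S = "{i. x i \<noteq> bot}"
  let ?N = "normal_form f (\<lambda>i. ?\<delta> (x i))"
  have "f x \<le> sup ?N (?\<delta> (x i))" if "i \<in> ?S" for i
  proof -
    let ?z = "lower_cut x (x i)"
    have "{j. ?z j \<noteq> bot} \<subset> ?S"
      using that by (auto simp: lower_cut_def)
    then have "card {j. ?z j \<noteq> bot} < card ?S"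
      by (intro psubset_card_mono) auto
    then have "f ?z \<le> normal_form f (\<lambda>j. ?\<delta> (?z j))"
      by (rule less)
    also have "(\<lambda>j. ?\<delta> (?z j)) \<le> (\<lambda>j. ?\<delta> (x j))"
      by (auto intro!: monoD[OF assms(1)] simp: le_fun_def diagonal_section_def lower_cut_def)
    then have "normal_form f (\<lambda>j. ?\<delta> (?z j)) \<le> ?N"
      by (rule monoD[OF mono_polynomial_function[OF polynomial_function_normal_form]])
    finally have "f ?z \<le> ?N" .
    moreover have "f x = sup (inf (f x) (?\<delta> (x i))) (f ?z)"
      using assms(2,3)
      by (simp add: horizontally_sup_decomposable_def quasi_inf_homogeneous_def)
    ultimately show ?thesis
      by (metis inf_le2 sup.mono sup_commute)
  qed
  then have "f x \<le> sup ?N (meet_over ?S (\<lambda>i. ?\<delta> (x i)))"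
    by (rule le_sup_meet_over)
  moreover have "f x \<le> f (zero_one_tuple ?S)"
    by (auto intro!: monoD[OF assms(1)] simp: le_fun_def zero_one_tuple_def)
  ultimately have "f x \<le> sup ?N (inf (f (zero_one_tuple ?S)) (meet_over ?S (\<lambda>i. ?\<delta> (x i))))"
    by (simp add: sup_inf_distrib1 le_supI2)
  also have "\<dots> = ?N"
    by (simp add: normal_form_upper sup_absorb1)
  finally show ?case .
qed

lemma mono_imp_eq_med_bounds:
  fixes \<phi> :: "'x::bounded_lattice \<Rightarrow> 'y::lattice"
  assumes "mono \<phi>"
  shows "\<phi> x = med (\<phi> bot) (\<phi> x) (\<phi> top)"
proof -
  have "\<phi> bot \<le> \<phi> x" "\<phi> x \<le> \<phi> top" "\<phi> bot \<le> \<phi> top"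
    by (auto intro!: monoD[OF assms])
  then show ?thesis
    by (simp add: med_def inf_absorb1 inf_absorb2 sup_absorb1 sup_absorb2)
qed

lemma horizontally_sup_decomposable_imp_quasi_polynomial:
  fixes f :: "('n::finite \<Rightarrow> 'x::bounded_lattice) \<Rightarrow> 'y::{bounded_lattice, distrib_lattice}"
  assumes "mono f" "lattice_hom (diagonal_section f)"
    and "quasi_inf_homogeneous f" "horizontally_sup_decomposable f"
  shows "quasi_polynomial_function f"
proof -
  have "mono (diagonal_section f)"
    by (auto intro!: monoI monoD[OF assms(1)] simp: diagonal_section_def le_fun_def)
  moreover have "f x = normal_form f (\<lambda>i. diagonal_section f (x i))" for x
    using le_normal_form normal_form_le assms by (intro antisym) blast+
  ultimately show ?thesis
    unfolding quasi_polynomial_function_def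
    using polynomial_function_normal_form[of f] mono_imp_eq_med_bounds by blast
qed

section \<open>The characterization\<close>

theorem theorem13:
  fixes f :: "('n::finite \<Rightarrow> 'x::{bounded_lattice, distrib_lattice})
                \<Rightarrow> 'y::{bounded_lattice, distrib_lattice}"
  assumes "mono f"
    and "lattice_hom (diagonal_section f)"
  shows "(quasi_polynomial_function f \<longleftrightarrow>
            quasi_inf_homogeneous f \<and> quasi_sup_homogeneous f) \<and>
         (quasi_polynomial_function f \<longleftrightarrow>
            quasi_inf_homogeneous f \<and> horizontally_sup_decomposable f) \<and>
         (quasi_polynomial_function f \<longleftrightarrow>
            horizontally_inf_decomposable f \<and> quasi_sup_homogeneous f)"
proof -
  note dual = mono_dualize[OF assms(1)] lattice_hom_diagonal_dualize[OF assms(2)]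
  have i_ii: "quasi_inf_homogeneous f \<and> quasi_sup_homogeneous f"
    if "quasi_polynomial_function f"
    using quasi_polynomial_imp_quasi_homogeneous[OF that assms(2)] by blast
  have ii_iii: "horizontally_sup_decomposable f"
    if "quasi_inf_homogeneous f" "quasi_sup_homogeneous f"
    using quasi_homogeneous_imp_horizontally_sup_decomposable[OF assms(1) that] .
  have iii_i: "quasi_polynomial_function f"
    if "quasi_inf_homogeneous f" "horizontally_sup_decomposable f"
    using horizontally_sup_decomposable_imp_quasi_polynomial[OF assms that] .
  have ii_iv: "horizontally_inf_decomposable f"
    if "quasi_inf_homogeneous f" "quasi_sup_homogeneous f"
    using quasi_homogeneous_imp_horizontally_sup_decomposable[OF dual(1)] that
    by (simp add: quasi_inf_homogeneous_dualize quasi_sup_homogeneous_dualize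
        horizontally_sup_decomposable_dualize)
  \<comment> \<open>Quasi-homogeneity of the dual of \<^term>\<open>f\<close> comes from its being quasi-polynomial; it then
    carries the conclusion back to \<^term>\<open>f\<close>, because this pair of conditions is self-dual.\<close>
  have iv_ii: "quasi_inf_homogeneous f"
    if "horizontally_inf_decomposable f" "quasi_sup_homogeneous f"
  proof -
    have "quasi_polynomial_function (dualize f)"
      using horizontally_sup_decomposable_imp_quasi_polynomial[OF dual] that
      by (simp add: quasi_inf_homogeneous_dualize horizontally_sup_decomposable_dualize)
    then have "quasi_sup_homogeneous (dualize f)"
      using quasi_polynomial_imp_quasi_homogeneous(2) dual(2) by blast
    then show ?thesis
      by (simp add: quasi_sup_homogeneous_dualize)
  qed
  show ?thesis
    using i_ii ii_iii iii_i ii_iv iv_ii by blast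
qed

end
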